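(* Let $g^c$, $c\ge0$, be the metrics on $M=\mathbb{R}_{>0}\times\mathbb{R}^3$ defined in the context, and identify $M$ with the open unit ball in $\mathbb{C}^2$, with boundary $\partial M=S^3$, via the coordinates $(z_1,z_2)$ of the context. Let $p_\infty=(-1,0)\in S^3$. (i) For $c>0$, the conformal structure at the boundary $[g^c|_{\partial M}]$ is singular at $p_\infty$ ($z_1=-1$), and away from the singularity it is given by the nondegenerate conformal structure $$[g^c|_{\partial M}]=\left[\left.\left(2\,(\operatorname{Re}\eta)^2+\tfrac12\,(\operatorname{Im}\eta)^2+8c\left|d\left(\frac{z_2}{1+z_1}\right)\right|^2\right)\right|_{\partial M}\right],$$ where $$\eta=d\left(\frac{1-z_1}{1+z_1}\right)-\frac{2\,\overline z_2}{1+\overline z_1}\,d\left(\frac{z_2}{1+z_1}\right).$$ (ii) For $c=0$, the conformal structure at the boundary is supported only on the CR distribution $\mathscr D$ on $S^3$ and is given by $$[g^0|_{\mathscr D\times\mathscr D}]=\left[\left.\left|d\left(\frac{z_2}{1+z_1}\right)\right|^2\right|_{\mathscr D\times\mathscr D}\right].$$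
   Context: With coordinates $(\rho,\tilde\phi,\zeta^0,\tilde\zeta_0)$ on $M$, $\rho>0$, $$g^c=\frac{1}{4\rho^2}\left[\frac{\rho+2c}{\rho+c}\,d\rho^2+\frac{\rho+c}{\rho+2c}\,(d\tilde\phi+\zeta^0 d\tilde\zeta_0-\tilde\zeta_0 d\zeta^0)^2+2(\rho+2c)\left((d\tilde\zeta_0)^2+(d\zeta^0)^2\right)\right].$$ The diffeomorphism between $M$ and $\{|z_1|^2+|z_2|^2<1\}\subset\mathbb{C}^2$ is given by $$\rho=\operatorname{Re}\left(\frac{1-z_1}{1+z_1}\right)-\left|\frac{z_2}{1+z_1}\right|^2=\frac{1-|z_1|^2-|z_2|^2}{|1+z_1|^2},\quad \tilde\phi=-\operatorname{Im}\left(\frac{1-z_1}{1+z_1}\right),\quad \zeta^0+i\tilde\zeta_0=\frac{\sqrt2\,z_2}{1+z_1}.$$ The boundary $\partial M$ (the hyperplane $\rho=0$ together with a point at infinity $p_\infty$) corresponds to the unit sphere $S^3\subset\mathbb{C}^2$, with $p_\infty=(-1,0)$. For $c>0$, $[g^c|_{\partial M}]=[(4\rho^2g^c)|_{\partial M}]$ is the conformal class of the restriction to $\partial M$ of $4\rho^2g^c$. "Singular" at $p_\infty$ refers to the double pole that the structure has there. For a complex $1$-form $\alpha$, $|\alpha|^2$ means the symmetric tensor $(\operatorname{Re}\alpha)^2+(\operatorname{Im}\alpha)^2$. For $c=0$ one has, with $\eta$ as in the claim, $\rho g^0=\frac{1}{4\rho}|\eta|^2+\left|d\left(\frac{z_2}{1+z_1}\right)\right|^2$.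 At the boundary the second term stays finite and the first term blows up except on its kernel, which at the boundary becomes the CR distribution $\mathscr D$ on $S^3$, i.e. the maximal complex subbundle of $TS^3$, whose complexification is spanned by $\overline z_2\partial_{z_1}-\overline z_1\partial_{z_2}$ and its conjugate. The conformal structure at the boundary $[g^0|_{\mathscr D\times\mathscr D}]:=[(\rho g^0)|_{\mathscr D\times\mathscr D}]$ is the nondegenerate conformal structure on $\mathscr D$ obtained by keeping only the finite term; this is the sense of "supported only on $\mathscr D$". *)

theory Defs
  imports "HOL-Analysis.Analysis"
begin

text \<open>
  Points and tangent vectors of \<open>\<complex>\<^sup>2\<close> are pairs of complex numbers; the norm and
  inner product of the product type are the Euclidean ones, so \<open>ball 0 1\<close> is the open unit
  ball and \<open>sphere 0 1\<close> is \<open>S\<^sup>3\<close>.  A point of \<open>\<real>\<^sub>>\<^sub>0 \<times> \<real>\<^sup>3\<close>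
  is a tuple \<open>(\<rho>, \<phi>, \<zeta>\<^sup>0, \<zeta>\<^sub>0)\<close>.  A (symmetric) two-tensor field \<open>h\<close> is
  written \<open>h p v w\<close>, base point first.
\<close>

type_synonym C2 = "complex \<times> complex"
type_synonym R4 = "real \<times> real \<times> real \<times> real"
type_synonym form_field = "C2 \<Rightarrow> C2 \<Rightarrow> C2 \<Rightarrow> real"


subsection \<open>The metrics\<close>

text \<open>The last two arguments are tangent vectors, i.e. their components are the values of
  \<open>d\<rho>, d\<phi>, d\<zeta>\<^sup>0, d\<zeta>\<^sub>0\<close>.\<close>

fun gc :: "real \<Rightarrow> R4 \<Rightarrow> R4 \<Rightarrow> R4 \<Rightarrow> real" where
  "gc c (\<rho>, \<phi>, \<zeta>, \<zeta>t) (d\<rho>, d\<phi>, d\<zeta>, d\<zeta>t) (d\<rho>', d\<phi>', d\<zeta>', d\<zeta>t') =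
     1 / (4 * \<rho>\<^sup>2) *
       ((\<rho> + 2 * c) / (\<rho> + c) * (d\<rho> * d\<rho>')
        + (\<rho> + c) / (\<rho> + 2 * c)
            * ((d\<phi> + \<zeta> * d\<zeta>t - \<zeta>t * d\<zeta>) * (d\<phi>' + \<zeta> * d\<zeta>t' - \<zeta>t * d\<zeta>'))
        + 2 * (\<rho> + 2 * c) * (d\<zeta>t * d\<zeta>t' + d\<zeta> * d\<zeta>'))"


subsection \<open>The identification with the unit ball\<close>

definition p_inf :: C2 where
  "p_inf = (-1, 0)"

definition cayley :: "C2 \<Rightarrow> complex" where
  "cayley z = (1 - fst z) / (1 + fst z)"

definition quot :: "C2 \<Rightarrow> complex" where
  "quot z = snd z / (1 + fst z)"

definition rho :: "C2 \<Rightarrow> real" where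
  "rho z = Re (cayley z) - (cmod (quot z))\<^sup>2"

definition chart :: "C2 \<Rightarrow> R4" where
  "chart z = (rho z, - Im (cayley z),
     Re (complex_of_real (sqrt 2) * snd z / (1 + fst z)),
     Im (complex_of_real (sqrt 2) * snd z / (1 + fst z)))"

lemma one_plus_fst_nz:
  assumes "z \<in> cball 0 1 - {p_inf}"
  shows "1 + fst z \<noteq> 0"
proof
  assume "1 + fst z = 0"
  then have z1: "fst z = -1" by (simp add: add_eq_0_iff)
  have "norm z \<le> 1" using assms by simp
  then have "(norm (fst z))\<^sup>2 + (norm (snd z))\<^sup>2 \<le> 1"
    by (cases z) (simp add: norm_Pair)
  with z1 have "snd z = 0" by simp
  with z1 assms show False by (cases z) (simp add: p_inf_def)
qed

lemma rho_eq:
  assumes "1 + fst z \<noteq> 0"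
  shows "rho z = (1 - (cmod (fst z))\<^sup>2 - (cmod (snd z))\<^sup>2) / (cmod (1 + fst z))\<^sup>2"
proof -
  have "cmod (1 + fst z) \<noteq> 0" using assms by simp
  moreover have "Re (cayley z) = (1 - (cmod (fst z))\<^sup>2) / (cmod (1 + fst z))\<^sup>2"
    unfolding cayley_def Re_divide cmod_power2
    by (simp add: algebra_simps power2_eq_square)
  ultimately show ?thesis
    by (simp add: rho_def quot_def norm_divide power_divide diff_divide_distrib)
qed

lemma bij_betw_chart:
  "bij_betw chart (ball 0 1) ({0<..} \<times> UNIV)"
  "bij_betw chart (sphere 0 1 - {p_inf}) ({0} \<times> UNIV)"
proof -
  define finv where "finv = (\<lambda>(r::real, f::real, a::real, b::real).
    let w = Complex a b / sqrt 2; u = Complex (r + (cmod w)\<^sup>2) (- f); z1 = (1 - u) / (1 + u)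
    in (z1, w * (1 + z1)))"
  have finv_eq: "finv (r, f, a, b) = (let w = Complex a b / sqrt 2; u = Complex (r + (cmod w)\<^sup>2) (- f);
      z1 = (1 - u) / (1 + u) in (z1, w * (1 + z1)))" for r f a b
    by (simp only: finv_def prod.case)
  have sq2: "complex_of_real (sqrt 2) \<noteq> 0" by simp
  have left: "finv (chart z) = z" if "z \<in> cball 0 1 - {p_inf}" for z
  proof -
    have nz: "1 + fst z \<noteq> 0" using one_plus_fst_nz[OF that] .
    have w: "Complex (Re (sqrt 2 * snd z / (1 + fst z))) (Im (sqrt 2 * snd z / (1 + fst z)))
        / sqrt 2 = quot z"
      using sq2 by (simp add: quot_def complex_surj)
    have u: "Complex (rho z + (cmod (quot z))\<^sup>2) (- (- Im (cayley z))) = cayley z"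
      by (simp add: rho_def complex_surj)
    have e: "1 + cayley z = 2 / (1 + fst z)" "1 - cayley z = 2 * fst z / (1 + fst z)"
      using nz by (simp_all add: cayley_def field_simps)
    have "(1 - cayley z) / (1 + cayley z) = fst z" unfolding e using nz by simp
    moreover have "finv (chart z) = (let z1 = (1 - cayley z) / (1 + cayley z) in (z1, quot z * (1 + z1)))"
      unfolding chart_def by (simp only: finv_eq w u Let_def)
    ultimately show ?thesis using nz by (simp add: quot_def)
  qed
  have right: "chart (finv x) = x \<and> finv x \<in> cball 0 1 - {p_inf} \<and> 1 + fst (finv x) \<noteq> 0"
    if "0 \<le> fst x" for x
  proof -
    obtain r f a b where x: "x = (r, f, a, b)" by (cases x)
    define w where "w = Complex a b / sqrt 2"
    define u where "u = Complex (r + (cmod w)\<^sup>2) (- f)"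
    define z where "z = finv x"
    have z: "z = ((1 - u) / (1 + u), w * (1 + (1 - u) / (1 + u)))"
      by (simp add: z_def finv_eq x w_def u_def Let_def)
    have r0: "r \<ge> 0" using that x by simp
    have "Re (1 + u) > 0" using r0 by (simp add: u_def add_pos_nonneg)
    then have nu: "1 + u \<noteq> 0" by force
    have e: "1 + fst z = 2 / (1 + u)" "1 - fst z = 2 * u / (1 + u)"
      using nu by (simp_all add: z field_simps)
    have nz: "1 + fst z \<noteq> 0" using nu e by simp
    have cz: "cayley z = u" unfolding cayley_def e using nu by simp
    have qz: "quot z = w" unfolding quot_def using nz by (simp add: z)
    have rz: "rho z = r" by (simp add: rho_def cz qz u_def)
    have "complex_of_real (sqrt 2) * snd z / (1 + fst z) = sqrt 2 * w"
      using qz by (simp add: quot_def mult.assoc flip: times_divide_eq_right)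
    also have "\<dots> = Complex a b" using sq2 by (simp add: w_def)
    finally have "chart z = x"
      by (simp add: chart_def rz cz x u_def)
    moreover have "(1 - (cmod (fst z))\<^sup>2 - (cmod (snd z))\<^sup>2) / (cmod (1 + fst z))\<^sup>2 \<ge> 0"
      using rho_eq[OF nz] rz r0 by simp
    then have "1 - (cmod (fst z))\<^sup>2 - (cmod (snd z))\<^sup>2 \<ge> 0"
      using nz by (simp add: zero_le_divide_iff)
    then have "norm z \<le> 1" by (cases z) (simp add: norm_Pair)
    moreover have "z \<noteq> p_inf" using nz by (auto simp: p_inf_def)
    ultimately show ?thesis using nz by (simp add: z_def)
  qed
  have rho_norm: "rho z = (1 - (norm z)\<^sup>2) / (cmod (1 + fst z))\<^sup>2" if "1 + fst z \<noteq> 0" for z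
    using rho_eq[OF that] by (cases z) (simp add: norm_Pair)
  have pos: "rho z > 0 \<longleftrightarrow> norm z < 1" "rho z = 0 \<longleftrightarrow> norm z = 1" if "1 + fst z \<noteq> 0" for z
    unfolding rho_norm[OF that] using that
    by (simp_all add: zero_less_divide_iff power_less_one_iff power2_eq_1_iff)
       (smt (verit) norm_ge_zero)
  have fc: "fst (chart z) = rho z" for z by (simp add: chart_def)
  have "norm p_inf = 1" by (simp add: p_inf_def norm_Pair)
  then have ball: "z \<in> cball 0 1 - {p_inf}" if "z \<in> ball 0 1" for z
    using that by auto
  have sphere: "z \<in> cball 0 1 - {p_inf}" if "z \<in> sphere 0 1 - {p_inf}" for z
    using that by auto
  show "bij_betw chart (ball 0 1) ({0<..} \<times> UNIV)"
  proof (rule bij_betw_byWitness[where f' = finv])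
    show "\<forall>z\<in>ball 0 1. finv (chart z) = z" using left ball by blast
    show "\<forall>x\<in>{0<..} \<times> UNIV. chart (finv x) = x" using right by (auto simp: mem_Times_iff)
    have "fst (chart z) > 0" if "z \<in> ball 0 1" for z
      unfolding fc using pos(1)[OF one_plus_fst_nz[OF ball[OF that]]] that by simp
    then show "chart ` ball 0 1 \<subseteq> {0<..} \<times> UNIV"
      by (simp add: image_subset_iff mem_Times_iff)
    have "finv x \<in> ball 0 1" if "fst x > 0" for x
      using right[of x] fc[of "finv x"] pos(1)[of "finv x"] that by simp
    then show "finv ` ({0<..} \<times> UNIV) \<subseteq> ball 0 1"
      by (simp add: image_subset_iff mem_Times_iff)
  qed
  show "bij_betw chart (sphere 0 1 - {p_inf}) ({0} \<times> UNIV)"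
  proof (rule bij_betw_byWitness[where f' = finv])
    show "\<forall>z\<in>sphere 0 1 - {p_inf}. finv (chart z) = z" using left sphere by blast
    show "\<forall>x\<in>{0} \<times> UNIV. chart (finv x) = x" using right by (auto simp: mem_Times_iff)
    have "fst (chart z) = 0" if "z \<in> sphere 0 1 - {p_inf}" for z
      unfolding fc using pos(2)[OF one_plus_fst_nz[OF sphere[OF that]]] that by simp
    then show "chart ` (sphere 0 1 - {p_inf}) \<subseteq> {0} \<times> UNIV"
      unfolding image_subset_iff mem_Times_iff by blast
    have "finv x \<in> sphere 0 1 - {p_inf}" if "fst x = 0" for x
      using right[of x] fc[of "finv x"] pos(2)[of "finv x"] that by simp
    then show "finv ` ({0} \<times> UNIV) \<subseteq> sphere 0 1 - {p_inf}"
      by (intro image_subsetI) (simp only: mem_Times_iff singleton_iff)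
  qed
qed

text \<open>The pullback of \<open>gc c\<close> to the ball.\<close>

definition gball :: "real \<Rightarrow> form_field" where
  "gball c z v w = gc c (chart z) (frechet_derivative chart (at z) v)
                                 (frechet_derivative chart (at z) w)"


subsection \<open>One-forms and the distributions\<close>

definition dcayley :: "C2 \<Rightarrow> C2 \<Rightarrow> complex" where
  "dcayley z v = frechet_derivative cayley (at z) v"

definition dquot :: "C2 \<Rightarrow> C2 \<Rightarrow> complex" where
  "dquot z v = frechet_derivative quot (at z) v"

definition eta :: "C2 \<Rightarrow> C2 \<Rightarrow> complex" where
  "eta z v = dcayley z v - 2 * cnj (snd z) / (1 + cnj (fst z)) * dquot z v"

definition ker_eta :: "C2 \<Rightarrow> C2 set" where
  "ker_eta z = {v. eta z v = 0}"

text \<open>\<open>|\<alpha>|\<^sup>2 = (Re \<alpha>)\<^sup>2 + (Im \<alpha>)\<^sup>2\<close>, polarised.\<close>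

definition abs_sq :: "(C2 \<Rightarrow> C2 \<Rightarrow> complex) \<Rightarrow> form_field" where
  "abs_sq \<alpha> z v w = Re (\<alpha> z v) * Re (\<alpha> z w) + Im (\<alpha> z v) * Im (\<alpha> z w)"

definition h_pos :: "real \<Rightarrow> form_field" where
  "h_pos c z v w = 2 * (Re (eta z v) * Re (eta z w)) + 1 / 2 * (Im (eta z v) * Im (eta z w))
     + 8 * c * abs_sq dquot z v w"

text \<open>The tangent space of the unit sphere, and its maximal complex subspace.\<close>

definition TS3 :: "C2 \<Rightarrow> C2 set" where
  "TS3 p = {v. p \<bullet> v = 0}"

definition CR :: "C2 \<Rightarrow> C2 set" where
  "CR p = {v. v \<in> TS3 p \<and> (\<i> * fst v, \<i> * snd v) \<in> TS3 p}"


subsection \<open>Conformal structures\<close>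

text \<open>\<open>Ck_on k U f\<close> is the usual \<open>C\<^sup>k\<close> condition when \<open>U\<close> is open; a function on an
  arbitrary set is smooth if it is the restriction of a smooth function on a neighbourhood.\<close>

fun Ck_on :: "nat \<Rightarrow> 'a::real_normed_vector set \<Rightarrow> ('a \<Rightarrow> real) \<Rightarrow> bool" where
  "Ck_on 0 U f = continuous_on U f"
| "Ck_on (Suc k) U f = ((\<forall>x\<in>U. f differentiable (at x)) \<and>
     (\<forall>v. Ck_on k U (\<lambda>x. frechet_derivative f (at x) v)))"

definition smooth_on :: "'a::real_normed_vector set \<Rightarrow> ('a \<Rightarrow> real) \<Rightarrow> bool" where
  "smooth_on S f \<longleftrightarrow>
     (\<exists>W F. open W \<and> S \<subseteq> W \<and> (\<forall>k. Ck_on k W F) \<and> (\<forall>x\<in>S. F x = f x))"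

text \<open>The conformal class of \<open>h\<close> as a tensor field on the bundle \<open>E\<close> over \<open>S\<close>.  Since only the
  values over \<open>S\<close> and on \<open>E\<close> are constrained, two classes are equal iff their representatives
  agree there up to a positive smooth factor.\<close>

definition conf_class :: "C2 set \<Rightarrow> (C2 \<Rightarrow> C2 set) \<Rightarrow> form_field \<Rightarrow> form_field set" where
  "conf_class S E h = {k. \<exists>\<mu>. smooth_on S \<mu> \<and> (\<forall>p\<in>S. \<mu> p > 0) \<and>
     (\<forall>p\<in>S. \<forall>v\<in>E p. \<forall>w\<in>E p. k p v w = \<mu> p * h p v w)}"

definition nondegenerate :: "C2 set \<Rightarrow> (C2 \<Rightarrow> C2 \<Rightarrow> real) \<Rightarrow> bool" where
  "nondegenerate V b \<longleftrightarrow> (\<forall>v\<in>V. (\<forall>w\<in>V. b v w = 0) \<longrightarrow> v = 0)"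

text \<open>Limits of tensor fields are taken on the total space of \<open>E \<oplus> E\<close>, so that \<open>E\<close> may vary with
  the base point.\<close>

definition total_space :: "C2 set \<Rightarrow> (C2 \<Rightarrow> C2 set) \<Rightarrow> (C2 \<times> C2 \<times> C2) set" where
  "total_space S E = {(z, v, w). z \<in> S \<and> v \<in> E z \<and> w \<in> E z}"

definition form_tendsto ::
    "C2 set \<Rightarrow> (C2 \<Rightarrow> C2 set) \<Rightarrow> form_field \<Rightarrow> C2 \<Rightarrow> (C2 \<Rightarrow> C2 \<Rightarrow> real) \<Rightarrow> bool" where
  "form_tendsto S E h p b \<longleftrightarrow> (\<forall>v\<in>E p. \<forall>w\<in>E p.
     ((\<lambda>(z, x, y). h z x y) \<longlongrightarrow> b v w) (at (p, v, w) within total_space S E))"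

text \<open>The restriction to the boundary of the part on \<open>E\<close> of a tensor field \<open>h\<close> on the ball, by
  continuous extension; meaningful where \<open>extends_to_bdry\<close> holds.\<close>

definition extends_to_bdry :: "(C2 \<Rightarrow> C2 set) \<Rightarrow> form_field \<Rightarrow> C2 \<Rightarrow> bool" where
  "extends_to_bdry E h p \<longleftrightarrow> (\<exists>b. form_tendsto (ball 0 1) E h p b)"

definition bdry_value :: "(C2 \<Rightarrow> C2 set) \<Rightarrow> form_field \<Rightarrow> form_field" where
  "bdry_value E h p v w = Lim (at (p, v, w) within total_space (ball 0 1) E) (\<lambda>(z, x, y). h z x y)"

definition bdry :: "C2 set" where
  "bdry = sphere 0 1 - {p_inf}"

text \<open>A tensor \<open>|\<alpha>|\<^sup>2\<close> whose one-form \<open>\<alpha>\<close> has a double pole in \<open>1 + z\<^sub>1\<close> has the factor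
  \<open>|(1 + z\<^sub>1)\<^sup>2|\<^sup>2\<close> in its denominator; the order is exact because the limit is nonzero.\<close>

definition double_pole_at_inf :: "(C2 \<Rightarrow> C2 set) \<Rightarrow> form_field \<Rightarrow> bool" where
  "double_pole_at_inf E h \<longleftrightarrow> (\<exists>b.
     form_tendsto bdry E (\<lambda>z v w. (cmod ((1 + fst z)\<^sup>2))\<^sup>2 * h z v w) p_inf b \<and>
     (\<exists>v\<in>E p_inf. \<exists>w\<in>E p_inf. b v w \<noteq> 0))"

text \<open>Some representative of the conformal class \<open>K\<close> extends continuously across \<open>p_inf\<close> with
  nondegenerate value there.\<close>

definition extends_across_inf :: "(C2 \<Rightarrow> C2 set) \<Rightarrow> form_field set \<Rightarrow> bool" where
  "extends_across_inf E K \<longleftrightarrow>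
     (\<exists>k\<in>K. \<exists>b. form_tendsto bdry E k p_inf b \<and> nondegenerate (E p_inf) b)"


subsection \<open>The conformal structures at the boundary\<close>

definition scaled_pos :: "real \<Rightarrow> form_field" where
  "scaled_pos c z v w = 4 * (rho z)\<^sup>2 * gball c z v w"

definition bdry_form_pos :: "real \<Rightarrow> form_field" where
  "bdry_form_pos c = bdry_value (\<lambda>_. UNIV) (scaled_pos c)"

definition conf_inf_pos :: "real \<Rightarrow> form_field set" where
  "conf_inf_pos c = conf_class bdry TS3 (bdry_form_pos c)"

text \<open>For \<open>c = 0\<close> the term \<open>|\<eta>|\<^sup>2 / (4 \<rho>)\<close> of \<open>\<rho> g\<^sup>0\<close> is unbounded near the boundary, and only
  the part of \<open>\<rho> g\<^sup>0\<close> on the kernel of \<open>\<eta>\<close> has boundary values.\<close>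

definition scaled_zero :: form_field where
  "scaled_zero z v w = rho z * gball 0 z v w"

definition bdry_form_zero :: form_field where
  "bdry_form_zero = bdry_value ker_eta scaled_zero"

definition conf_inf_zero :: "form_field set" where
  "conf_inf_zero = conf_class bdry CR bdry_form_zero"

end

theory Submission
  imports Defs
begin

text \<open>
  Write \<open>u = (1 - z\<^sub>1) / (1 + z\<^sub>1)\<close> and \<open>w = z\<^sub>2 / (1 + z\<^sub>1)\<close>.  The differentials of the
  coordinates are \<open>d\<rho> = Re \<eta>\<close>, \<open>d\<phi> + \<zeta>\<^sup>0 d\<zeta>\<^sub>0 - \<zeta>\<^sub>0 d\<zeta>\<^sup>0 = - Im \<eta>\<close> and
  \<open>d\<zeta>\<^sup>0 + \<i> d\<zeta>\<^sub>0 = \<surd>2 dw\<close>, where \<open>\<eta> = du - 2 cnj w dw\<close>.  So the metric on the ball is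
  (\<open>gball_eq\<close>)
  \<open>1 / (4 \<rho>\<^sup>2) [(\<rho> + 2c) / (\<rho> + c) (Re \<eta>)\<^sup>2 + (\<rho> + c) / (\<rho> + 2c) (Im \<eta>)\<^sup>2 + 4 (\<rho> + 2c) |dw|\<^sup>2]\<close>.
  For \<open>c > 0\<close> the bracket is continuous up to \<open>\<rho> = 0\<close>, where the coefficients are
  \<open>2\<close>, \<open>1/2\<close> and \<open>8c\<close>.  For \<open>c = 0\<close> it gives \<open>\<rho> g = |\<eta>|\<^sup>2 / (4 \<rho>) + |dw|\<^sup>2\<close>: this blows up
  off the kernel of \<open>\<eta>\<close> and equals \<open>|dw|\<^sup>2\<close> on it.  Both forms are nondegenerate because
  \<open>\<eta>\<close> and \<open>dw\<close> together determine \<open>dz\<^sub>1\<close> and \<open>dz\<^sub>2\<close>.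

  On the sphere \<open>\<eta>\<close> is \<open>- 2 / |1 + z\<^sub>1|\<^sup>2\<close> times the Hermitian pairing with the position vector
  (\<open>eta_bdry\<close>).  Its real part therefore vanishes on the tangent space and its kernel is the
  CR distribution.

  At \<open>p_inf\<close>, multiplying the form for \<open>c > 0\<close> by \<open>|(1 + z\<^sub>1)\<^sup>2|\<^sup>2\<close> leaves the limit
  \<open>2 (Im v\<^sub>1)\<^sup>2\<close> on the tangent space (\<open>form_tendsto_pole\<close>).  This limit has rank one, and it
  is the reason that no rescaling extends across \<open>p_inf\<close>: a factor that makes the value on the
  direction of \<open>Im v\<^sub>1\<close> converge makes the value on \<open>v\<^sub>1 = 0\<close> tend to zero.  For \<open>c = 0\<close>, in
  contrast, \<open>|1 + z\<^sub>1|\<^sup>2 |dw|\<^sup>2\<close> restricted to the CR distribution is the Euclidean inner product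
  (\<open>CR_inner_eq\<close>), which is smooth everywhere.
\<close>

section \<open>The coordinate forms\<close>

lemma has_derivative_cayley:
  assumes "1 + fst z \<noteq> 0"
  shows "(cayley has_derivative (\<lambda>v. - 2 * fst v / (1 + fst z)\<^sup>2)) (at z)"
proof -
  have "((\<lambda>z. (1 - fst z) / (1 + fst z)) has_derivative
      (\<lambda>v. - 2 * fst v / (1 + fst z)\<^sup>2)) (at z)"
    using assms
    by (auto intro!: derivative_eq_intros simp: field_simps power2_eq_square)
  then show ?thesis by (simp add: cayley_def [abs_def])
qed

lemma has_derivative_quot:
  assumes "1 + fst z \<noteq> 0"
  shows "(quot has_derivative (\<lambda>v. snd v / (1 + fst z) - snd z * fst v / (1 + fst z)\<^sup>2)) (at z)"
proof -
  have eq: "(b * D - c * a) / (D * D) = b / D - c * a / D\<^sup>2" if "D \<noteq> 0" for a b c D :: complex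
    using that by (simp add: diff_divide_distrib power2_eq_square)
  have "((\<lambda>z. snd z / (1 + fst z)) has_derivative
      (\<lambda>v. (snd v * (1 + fst z) - snd z * fst v) / ((1 + fst z) * (1 + fst z)))) (at z)"
    using assms by (auto intro!: derivative_eq_intros)
  then have "((\<lambda>z. snd z / (1 + fst z)) has_derivative
      (\<lambda>v. snd v / (1 + fst z) - snd z * fst v / (1 + fst z)\<^sup>2)) (at z)"
    by (simp only: eq [OF assms])
  then show ?thesis by (simp add: quot_def [abs_def])
qed

lemma dcayley_eq: "1 + fst z \<noteq> 0 \<Longrightarrow> dcayley z v = - 2 * fst v / (1 + fst z)\<^sup>2"
  using frechet_derivative_at [OF has_derivative_cayley, symmetric] by (simp add: dcayley_def)

lemma dquot_eq:
  "1 + fst z \<noteq> 0 \<Longrightarrow> dquot z v = snd v / (1 + fst z) - snd z * fst v / (1 + fst z)\<^sup>2"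
  using frechet_derivative_at [OF has_derivative_quot, symmetric] by (simp add: dquot_def)

lemma eta_eq: "eta z v = dcayley z v - 2 * cnj (quot z) * dquot z v"
  by (simp add: eta_def quot_def)

lemma dquot_diff: "1 + fst z \<noteq> 0 \<Longrightarrow> dquot z (v - w) = dquot z v - dquot z w"
  by (simp add: dquot_eq right_diff_distrib diff_divide_distrib)

lemma dcayley_diff: "1 + fst z \<noteq> 0 \<Longrightarrow> dcayley z (v - w) = dcayley z v - dcayley z w"
  by (simp add: dcayley_eq right_diff_distrib diff_divide_distrib)

lemma eta_diff: "1 + fst z \<noteq> 0 \<Longrightarrow> eta z (v - w) = eta z v - eta z w"
  by (simp add: eta_eq dquot_diff dcayley_diff right_diff_distrib)

text \<open>
  In matrix form \<open>(du, dw)\<close> is triangular in \<open>(dz\<^sub>1, dz\<^sub>2)\<close> with diagonal entries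
  \<open>- 2 / (1 + z\<^sub>1)\<^sup>2\<close> and \<open>1 / (1 + z\<^sub>1)\<close>, and \<open>\<eta>\<close> differs from \<open>du\<close> by a multiple of \<open>dw\<close>.
\<close>

lemma coordinate_forms_injective:
  assumes nz: "1 + fst z \<noteq> 0" and "eta z v = 0" and q: "dquot z v = 0"
  shows "v = 0"
proof -
  have "dcayley z v = 0" using assms by (simp add: eta_eq)
  then have "fst v = 0" using nz by (simp add: dcayley_eq)
  moreover from this q have "snd v = 0" using nz by (simp add: dquot_eq)
  ultimately show ?thesis by (simp add: prod_eq_iff)
qed

lemma has_derivative_chart:
  assumes "1 + fst z \<noteq> 0"
  shows "(chart has_derivative (\<lambda>v. (Re (eta z v), - Im (dcayley z v),
           sqrt 2 * Re (dquot z v), sqrt 2 * Im (dquot z v)))) (at z)"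
proof -
  have c: "(cayley has_derivative dcayley z) (at z)"
    using has_derivative_cayley [OF assms] by (simp add: dcayley_eq [OF assms, abs_def])
  have q: "(quot has_derivative dquot z) (at z)"
    using has_derivative_quot [OF assms] by (simp add: dquot_eq [OF assms, abs_def])
  have eq: "chart = (\<lambda>z. (Re (cayley z) - ((Re (quot z))\<^sup>2 + (Im (quot z))\<^sup>2), - Im (cayley z),
      sqrt 2 * Re (quot z), sqrt 2 * Im (quot z)))"
    by (rule ext) (simp add: chart_def rho_def cmod_power2 quot_def flip: times_divide_eq_right)
  note d = bounded_linear.has_derivative [OF bounded_linear_Re c]
    bounded_linear.has_derivative [OF bounded_linear_Im c]
    bounded_linear.has_derivative [OF bounded_linear_Re q]
    bounded_linear.has_derivative [OF bounded_linear_Im q]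
  have "((\<lambda>z. Re (cayley z) - ((Re (quot z))\<^sup>2 + (Im (quot z))\<^sup>2)) has_derivative
      (\<lambda>v. Re (eta z v))) (at z)"
    by (auto intro!: derivative_eq_intros c q simp: eta_eq algebra_simps)
  then show ?thesis
    unfolding eq
    by (intro has_derivative_Pair has_derivative_minus has_derivative_mult_right d)
qed

text \<open>
  The \<open>\<zeta>\<close> terms combine to \<open>2 Im (cnj w dw)\<close>, which turns \<open>- Im du\<close> into \<open>- Im \<eta>\<close>; the factor
  \<open>\<surd>2\<close> in \<open>\<zeta>\<^sup>0 + \<i> \<zeta>\<^sub>0 = \<surd>2 w\<close> turns the coefficient \<open>2 (\<rho> + 2c)\<close> into \<open>4 (\<rho> + 2c)\<close>.
\<close>

lemma gball_eq:
  assumes "1 + fst z \<noteq> 0"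
  shows "gball c z v w = 1 / (4 * (rho z)\<^sup>2) *
      ((rho z + 2 * c) / (rho z + c) * (Re (eta z v) * Re (eta z w))
       + (rho z + c) / (rho z + 2 * c) * (Im (eta z v) * Im (eta z w))
       + 4 * (rho z + 2 * c) * abs_sq dquot z v w)"
proof -
  have d: "frechet_derivative chart (at z) v = (Re (eta z v), - Im (dcayley z v),
           sqrt 2 * Re (dquot z v), sqrt 2 * Im (dquot z v))" for v
    using frechet_derivative_at [OF has_derivative_chart [OF assms], symmetric] by simp
  have ch: "chart z = (rho z, - Im (cayley z), sqrt 2 * Re (quot z), sqrt 2 * Im (quot z))"
    by (simp add: chart_def quot_def flip: times_divide_eq_right)
  have phi: "- Im (dcayley z v) + sqrt 2 * Re (quot z) * (sqrt 2 * Im (dquot z v))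
      - sqrt 2 * Im (quot z) * (sqrt 2 * Re (dquot z v)) = - Im (eta z v)" for v
    by (simp add: eta_eq algebra_simps)
  have zeta: "sqrt 2 * Im (dquot z v) * (sqrt 2 * Im (dquot z w))
      + sqrt 2 * Re (dquot z v) * (sqrt 2 * Re (dquot z w)) = 2 * abs_sq dquot z v w"
    by (simp add: abs_sq_def algebra_simps)
  show ?thesis
    unfolding gball_def d ch gc.simps phi zeta by (simp add: algebra_simps)
qed

lemma scaled_pos_eq:
  assumes "1 + fst z \<noteq> 0" "rho z \<noteq> 0"
  shows "scaled_pos c z v w = (rho z + 2 * c) / (rho z + c) * (Re (eta z v) * Re (eta z w))
       + (rho z + c) / (rho z + 2 * c) * (Im (eta z v) * Im (eta z w))
       + 4 * (rho z + 2 * c) * abs_sq dquot z v w"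
  using assms by (simp add: scaled_pos_def gball_eq)

lemma scaled_zero_eq:
  assumes "1 + fst z \<noteq> 0" "rho z \<noteq> 0"
  shows "scaled_zero z v w = abs_sq eta z v w / (4 * rho z) + abs_sq dquot z v w"
proof -
  have "scaled_zero z v w
      = rho z * (1 / (4 * (rho z)\<^sup>2) * (abs_sq eta z v w + 4 * rho z * abs_sq dquot z v w))"
    using assms by (simp add: scaled_zero_def gball_eq abs_sq_def)
  also have "\<dots> = abs_sq eta z v w / (4 * rho z) + abs_sq dquot z v w"
    using assms(2) by (simp add: field_simps power2_eq_square)
  finally show ?thesis .
qed


section \<open>Behaviour near the boundary\<close>

lemma ball_nz:
  fixes z :: C2
  assumes "z \<in> ball 0 1" shows "1 + fst z \<noteq> 0"
proof -
  have "norm p_inf = 1" by (simp add: p_inf_def norm_Pair)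
  then have "z \<in> cball 0 1 - {p_inf}" using assms by auto
  then show ?thesis by (rule one_plus_fst_nz)
qed

lemma bdry_nz: "p \<in> bdry \<Longrightarrow> 1 + fst p \<noteq> 0"
  by (rule one_plus_fst_nz) (auto simp: bdry_def)

lemma rho_pos: "z \<in> ball 0 1 \<Longrightarrow> rho z > 0"
  using bij_betw_apply [OF bij_betw_chart(1)] by (simp add: chart_def)

lemma rho_bdry: "p \<in> bdry \<Longrightarrow> rho p = 0"
  using bij_betw_apply [OF bij_betw_chart(2)] by (simp add: chart_def bdry_def)

lemma tendsto_nz:
  fixes f :: "'a \<Rightarrow> C2"
  assumes "(f \<longlongrightarrow> p) F" and "1 + fst p \<noteq> 0"
  shows "\<forall>\<^sub>F x in F. 1 + fst (f x) \<noteq> 0"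
proof -
  have "((\<lambda>x. 1 + fst (f x)) \<longlongrightarrow> 1 + fst p) F"
    by (intro tendsto_intros assms)
  then show ?thesis using assms(2) by (rule tendsto_imp_eventually_ne)
qed

lemma tendsto_dquot:
  assumes f: "(f \<longlongrightarrow> p) F" and g: "(g \<longlongrightarrow> v) F" and p: "1 + fst p \<noteq> 0"
  shows "((\<lambda>x. dquot (f x) (g x)) \<longlongrightarrow> dquot p v) F"
proof (rule Lim_transform_eventually)
  show "((\<lambda>x. snd (g x) / (1 + fst (f x)) - snd (f x) * fst (g x) / (1 + fst (f x))\<^sup>2)
      \<longlongrightarrow> dquot p v) F"
    unfolding dquot_eq [OF p] using p by (intro tendsto_intros f g) auto
  show "\<forall>\<^sub>F x in F. snd (g x) / (1 + fst (f x)) - snd (f x) * fst (g x) / (1 + fst (f x))\<^sup>2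
      = dquot (f x) (g x)"
    using tendsto_nz [OF f p] by eventually_elim (simp add: dquot_eq)
qed

lemma tendsto_dcayley:
  assumes f: "(f \<longlongrightarrow> p) F" and g: "(g \<longlongrightarrow> v) F" and p: "1 + fst p \<noteq> 0"
  shows "((\<lambda>x. dcayley (f x) (g x)) \<longlongrightarrow> dcayley p v) F"
proof (rule Lim_transform_eventually)
  show "((\<lambda>x. - 2 * fst (g x) / (1 + fst (f x))\<^sup>2) \<longlongrightarrow> dcayley p v) F"
    unfolding dcayley_eq [OF p] using p by (intro tendsto_intros f g) auto
  show "\<forall>\<^sub>F x in F. - 2 * fst (g x) / (1 + fst (f x))\<^sup>2 = dcayley (f x) (g x)"
    using tendsto_nz [OF f p] by eventually_elim (simp add: dcayley_eq)
qed

lemma tendsto_quot: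
  assumes "(f \<longlongrightarrow> p) F" and "1 + fst p \<noteq> 0"
  shows "((\<lambda>x. quot (f x)) \<longlongrightarrow> quot p) F"
  unfolding quot_def by (intro tendsto_intros assms)

lemma tendsto_rho:
  assumes "(f \<longlongrightarrow> p) F" and "1 + fst p \<noteq> 0"
  shows "((\<lambda>x. rho (f x)) \<longlongrightarrow> rho p) F"
  unfolding rho_def cayley_def by (intro tendsto_intros tendsto_quot assms)

lemma tendsto_eta:
  assumes "(f \<longlongrightarrow> p) F" and "(g \<longlongrightarrow> v) F" and "1 + fst p \<noteq> 0"
  shows "((\<lambda>x. eta (f x) (g x)) \<longlongrightarrow> eta p v) F"
  unfolding eta_eq
  by (intro tendsto_intros tendsto_cnj tendsto_dcayley tendsto_dquot tendsto_quot assms)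

lemma tendsto_abs_sq_dquot:
  assumes "(f \<longlongrightarrow> p) F" and "(g \<longlongrightarrow> v) F" and "(h \<longlongrightarrow> w) F" and "1 + fst p \<noteq> 0"
  shows "((\<lambda>x. abs_sq dquot (f x) (g x) (h x)) \<longlongrightarrow> abs_sq dquot p v w) F"
  unfolding abs_sq_def by (intro tendsto_intros tendsto_dquot assms)

text \<open>
  A limit along the total space may be computed with any expression \<open>h'\<close> that agrees with
  \<open>h\<close> there.  This permits the closed formulas, which hold only over \<open>S\<close>.
\<close>

lemma form_tendstoI:
  assumes "\<And>v w. v \<in> E p \<Longrightarrow> w \<in> E p \<Longrightarrow>
      ((\<lambda>t. h' (fst t) (fst (snd t)) (snd (snd t))) \<longlongrightarrow> b v w) (at (p, v, w) within total_space S E)"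
    and "\<And>z x y. z \<in> S \<Longrightarrow> x \<in> E z \<Longrightarrow> y \<in> E z \<Longrightarrow> h' z x y = h z x y"
  shows "form_tendsto S E h p b"
  unfolding form_tendsto_def
proof (intro ballI)
  fix v w assume vw: "v \<in> E p" "w \<in> E p"
  have "\<forall>\<^sub>F t in at (p, v, w) within total_space S E.
      h' (fst t) (fst (snd t)) (snd (snd t)) = (case t of (z, x, y) \<Rightarrow> h z x y)"
    unfolding eventually_at_filter
    by (rule always_eventually) (auto simp: total_space_def assms(2))
  then show "((\<lambda>(z, x, y). h z x y) \<longlongrightarrow> b v w) (at (p, v, w) within total_space S E)"
    by (rule Lim_transform_eventually [OF assms(1) [OF vw]])
qed

lemma tendsto_at_triple:
  "((\<lambda>t. fst t) \<longlongrightarrow> p) (at (p, v, w) within T)"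
  "((\<lambda>t. fst (snd t)) \<longlongrightarrow> v) (at (p, v, w) within T)"
  "((\<lambda>t. snd (snd t)) \<longlongrightarrow> w) (at (p, v, w) within T)"
  using tendsto_fst [OF tendsto_ident_at [of "(p, v, w)" T]]
    tendsto_fst [OF tendsto_snd [OF tendsto_ident_at [of "(p, v, w)" T]]]
    tendsto_snd [OF tendsto_snd [OF tendsto_ident_at [of "(p, v, w)" T]]]
  by simp_all

lemma form_tendsto_scaled_pos:
  assumes "c > 0" "p \<in> bdry"
  shows "form_tendsto (ball 0 1) (\<lambda>_. UNIV) (scaled_pos c) p (h_pos c p)"
proof (rule form_tendstoI)
  fix v w :: C2
  note nz = bdry_nz [OF assms(2)]
  let ?F = "at (p, v, w) within total_space (ball 0 1) (\<lambda>_. UNIV)"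
  note t = tendsto_at_triple [where T = "total_space (ball 0 1) (\<lambda>_. UNIV)"]
  have "((\<lambda>t. (rho (fst t) + 2 * c) / (rho (fst t) + c)
         * (Re (eta (fst t) (fst (snd t))) * Re (eta (fst t) (snd (snd t))))
       + (rho (fst t) + c) / (rho (fst t) + 2 * c)
         * (Im (eta (fst t) (fst (snd t))) * Im (eta (fst t) (snd (snd t))))
       + 4 * (rho (fst t) + 2 * c) * abs_sq dquot (fst t) (fst (snd t)) (snd (snd t)))
    \<longlongrightarrow> (rho p + 2 * c) / (rho p + c) * (Re (eta p v) * Re (eta p w))
       + (rho p + c) / (rho p + 2 * c) * (Im (eta p v) * Im (eta p w))
       + 4 * (rho p + 2 * c) * abs_sq dquot p v w) ?F"
    using assms(1)
    by (intro tendsto_intros tendsto_rho tendsto_eta tendsto_abs_sq_dquot t nz)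
       (simp_all add: rho_bdry [OF assms(2)])
  also have "(rho p + 2 * c) / (rho p + c) * (Re (eta p v) * Re (eta p w))
       + (rho p + c) / (rho p + 2 * c) * (Im (eta p v) * Im (eta p w))
       + 4 * (rho p + 2 * c) * abs_sq dquot p v w = h_pos c p v w"
    using assms(1) by (simp add: rho_bdry [OF assms(2)] h_pos_def)
  finally show "((\<lambda>t. (rho (fst t) + 2 * c) / (rho (fst t) + c)
         * (Re (eta (fst t) (fst (snd t))) * Re (eta (fst t) (snd (snd t))))
       + (rho (fst t) + c) / (rho (fst t) + 2 * c)
         * (Im (eta (fst t) (fst (snd t))) * Im (eta (fst t) (snd (snd t))))
       + 4 * (rho (fst t) + 2 * c) * abs_sq dquot (fst t) (fst (snd t)) (snd (snd t)))
    \<longlongrightarrow> h_pos c p v w) ?F" .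
next
  fix z x y :: C2 assume z: "z \<in> ball 0 1"
  show "(rho z + 2 * c) / (rho z + c) * (Re (eta z x) * Re (eta z y))
       + (rho z + c) / (rho z + 2 * c) * (Im (eta z x) * Im (eta z y))
       + 4 * (rho z + 2 * c) * abs_sq dquot z x y = scaled_pos c z x y"
    using scaled_pos_eq [OF ball_nz [OF z]] rho_pos [OF z] by simp
qed

lemma form_tendsto_scaled_zero:
  assumes "p \<in> bdry"
  shows "form_tendsto (ball 0 1) ker_eta scaled_zero p (abs_sq dquot p)"
proof (rule form_tendstoI)
  show "((\<lambda>t. abs_sq dquot (fst t) (fst (snd t)) (snd (snd t))) \<longlongrightarrow> abs_sq dquot p v w)
      (at (p, v, w) within total_space (ball 0 1) ker_eta)" for v w
    by (intro tendsto_abs_sq_dquot tendsto_at_triple bdry_nz assms)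
  show "abs_sq dquot z x y = scaled_zero z x y"
    if z: "z \<in> ball 0 1" and "x \<in> ker_eta z" for z x y
    using scaled_zero_eq [OF ball_nz [OF z]] rho_pos [OF z] that(2)
    by (simp add: ker_eta_def abs_sq_def [of eta])
qed

text \<open>
  The term \<open>|\<eta>|\<^sup>2 / (4 \<rho>)\<close> has a numerator with positive limit and a denominator that tends to
  zero from above; the remaining term \<open>|dw|\<^sup>2\<close> is nonnegative.
\<close>

lemma scaled_zero_at_top:
  assumes p: "p \<in> bdry" and v: "eta p v \<noteq> 0"
  shows "filterlim (\<lambda>(z, x). scaled_zero z x x) at_top (at (p, v) within ball 0 1 \<times> UNIV)"
proof -
  let ?F = "at (p, v) within ball 0 1 \<times> UNIV"
  note nz = bdry_nz [OF p]
  have t: "(fst \<longlongrightarrow> p) ?F" "(snd \<longlongrightarrow> v) ?F"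
    using tendsto_fst [OF tendsto_ident_at [of "(p, v)" "ball 0 1 \<times> UNIV"]]
      tendsto_snd [OF tendsto_ident_at [of "(p, v)" "ball 0 1 \<times> UNIV"]] by simp_all
  have ball: "\<forall>\<^sub>F t in ?F. fst t \<in> ball 0 1"
    unfolding eventually_at_filter by (rule always_eventually) auto
  have "((\<lambda>t. abs_sq eta (fst t) (snd t) (snd t)) \<longlongrightarrow> abs_sq eta p v v) ?F"
    unfolding abs_sq_def by (intro tendsto_intros tendsto_eta t nz)
  moreover have "abs_sq eta p v v > 0"
    using v by (simp add: abs_sq_def complex_neq_0 flip: power2_eq_square)
  moreover have lim: "((\<lambda>t. 4 * rho (fst t)) \<longlongrightarrow> 4 * rho p) ?F"
    by (intro tendsto_intros tendsto_rho t nz)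
  have "filterlim (\<lambda>t. 4 * rho (fst t)) (at_right 0) ?F"
    unfolding filterlim_at
  proof (rule conjI)
    show "\<forall>\<^sub>F t in ?F. 4 * rho (fst t) \<in> {0<..} \<and> 4 * rho (fst t) \<noteq> 0"
      using ball by eventually_elim (use rho_pos in fastforce)
  qed (use lim rho_bdry [OF p] in simp)
  ultimately have inf: "filterlim (\<lambda>t. abs_sq eta (fst t) (snd t) (snd t) / (4 * rho (fst t))) at_top ?F"
    unfolding divide_inverse
    by (intro filterlim_tendsto_pos_mult_at_top filterlim_compose [OF filterlim_inverse_at_top_right])
  show ?thesis
  proof (rule filterlim_at_top_mono [OF inf])
    show "\<forall>\<^sub>F t in ?F. abs_sq eta (fst t) (snd t) (snd t) / (4 * rho (fst t))
        \<le> (case t of (z, x) \<Rightarrow> scaled_zero z x x)"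
      using ball
    proof eventually_elim
      case (elim t)
      then show ?case
        using scaled_zero_eq [OF ball_nz [OF elim]] rho_pos [OF elim]
        by (simp add: case_prod_beta abs_sq_def [of dquot])
    qed
  qed
qed


section \<open>Uniqueness of boundary values\<close>

text \<open>
  A section of \<open>E \<oplus> E\<close> through \<open>(v, w)\<close> transports limits on the total space to limits on the
  base.  It shows that the point \<open>(p, v, w)\<close> is approached at all, so that limits are unique,
  and it is also the means of comparing two such limits.  As \<open>p \<notin> S\<close>, the section never meets
  the limit point itself.
\<close>

lemma filterlim_section:
  assumes p: "p \<notin> S" and a: "(a \<longlongrightarrow> v) (at p within S)" and b: "(b \<longlongrightarrow> w) (at p within S)"
    and E: "\<And>z. z \<in> S \<Longrightarrow> a z \<in> E z \<and> b z \<in> E z"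
  shows "filterlim (\<lambda>z. (z, a z, b z)) (at (p, v, w) within total_space S E) (at p within S)"
  unfolding filterlim_at
proof
  show "((\<lambda>z. (z, a z, b z)) \<longlongrightarrow> (p, v, w)) (at p within S)"
    by (intro tendsto_Pair a b tendsto_ident_at)
  show "\<forall>\<^sub>F z in at p within S. (z, a z, b z) \<in> total_space S E \<and> (z, a z, b z) \<noteq> (p, v, w)"
    unfolding eventually_at_filter
    by (rule always_eventually) (auto simp: total_space_def E)
qed

lemma bdry_value_eq:
  assumes h: "form_tendsto (ball 0 1) E h p b" and p: "p \<in> bdry"
    and vw: "v \<in> E p" "w \<in> E p"
    and sec: "\<And>v. v \<in> E p \<Longrightarrow> \<exists>a. (a \<longlongrightarrow> v) (at p within ball 0 1) \<and> (\<forall>z\<in>ball 0 1. a z \<in> E z)"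
  shows "bdry_value E h p v w = b v w"
proof -
  obtain a a' where a: "(a \<longlongrightarrow> v) (at p within ball 0 1)" "\<forall>z\<in>ball 0 1. a z \<in> E z"
    and a': "(a' \<longlongrightarrow> w) (at p within ball 0 1)" "\<forall>z\<in>ball 0 1. a' z \<in> E z"
    using sec vw by meson
  have np: "norm p = 1" using p by (simp add: bdry_def)
  have "filterlim (\<lambda>z. (z, a z, a' z)) (at (p, v, w) within total_space (ball 0 1) E)
      (at p within ball 0 1)"
    using a a' np by (intro filterlim_section) auto
  moreover have "at p within ball 0 1 \<noteq> bot"
    unfolding trivial_limit_within islimpt_ball using np by simp
  ultimately have "at (p, v, w) within total_space (ball 0 1) E \<noteq> bot"
    by (auto simp: filterlim_def bot_unique filtermap_bot_iff)
  moreover have "((\<lambda>(z, x, y). h z x y) \<longlongrightarrow> b v w) (at (p, v, w) within total_space (ball 0 1) E)"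
    using h vw by (simp add: form_tendsto_def)
  ultimately show ?thesis unfolding bdry_value_def by (rule tendsto_Lim)
qed

lemma bdry_form_pos_eq:
  assumes "c > 0" "p \<in> bdry"
  shows "bdry_form_pos c p v w = h_pos c p v w"
  unfolding bdry_form_pos_def
proof (rule bdry_value_eq [OF form_tendsto_scaled_pos [OF assms] assms(2)])
  show "\<exists>a. (a \<longlongrightarrow> v) (at p within ball 0 1) \<and> (\<forall>z\<in>ball 0 1. a z \<in> UNIV)" for v :: C2
    by (intro exI [of _ "\<lambda>_. v"]) simp
qed simp_all

text \<open>
  The unique solution \<open>v\<close> of \<open>\<eta> v = 0\<close> and \<open>dw v = a\<close> at \<open>z\<close>.  Keeping \<open>a\<close> fixed and moving
  \<open>z\<close> gives a continuous section of the kernel of \<open>\<eta>\<close> through any prescribed kernel vector on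
  the boundary.
\<close>

definition ker_section :: "complex \<Rightarrow> C2 \<Rightarrow> C2" where
  "ker_section a z = (- (1 + fst z)\<^sup>2 * cnj (quot z) * a, (1 + fst z) * a * (1 - snd z * cnj (quot z)))"

lemma ker_section_forms:
  assumes "1 + fst z \<noteq> 0"
  shows "dquot z (ker_section a z) = a" and "eta z (ker_section a z) = 0"
proof -
  have "snd (ker_section a z) / (1 + fst z) = a * (1 - snd z * cnj (quot z))"
    using assms by (simp add: ker_section_def)
  moreover have "snd z * fst (ker_section a z) / (1 + fst z)\<^sup>2 = - snd z * cnj (quot z) * a"
    using assms by (simp add: ker_section_def)
  ultimately show q: "dquot z (ker_section a z) = a"
    by (simp add: dquot_eq [OF assms] algebra_simps)
  show "eta z (ker_section a z) = 0"
    using assms unfolding eta_eq q by (simp add: dcayley_eq ker_section_def)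
qed

lemma ker_section_dquot:
  assumes nz: "1 + fst z \<noteq> 0" and "eta z v = 0"
  shows "ker_section (dquot z v) z = v"
proof -
  let ?u = "v - ker_section (dquot z v) z"
  have "?u = 0"
    using assms by (intro coordinate_forms_injective [OF nz])
      (simp_all add: ker_section_forms eta_diff dquot_diff)
  then show ?thesis by simp
qed

lemma bdry_form_zero_eq:
  assumes "p \<in> bdry" "v \<in> ker_eta p" "w \<in> ker_eta p"
  shows "bdry_form_zero p v w = abs_sq dquot p v w"
  unfolding bdry_form_zero_def
proof (rule bdry_value_eq [OF form_tendsto_scaled_zero [OF assms(1)] assms])
  fix v assume "v \<in> ker_eta p"
  then have v: "ker_section (dquot p v) p = v"
    using ker_section_dquot [OF bdry_nz [OF assms(1)]] by (simp add: ker_eta_def)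
  have "(ker_section (dquot p v) \<longlongrightarrow> ker_section (dquot p v) p) (at p within ball 0 1)"
    unfolding ker_section_def
    by (intro tendsto_intros tendsto_cnj tendsto_quot bdry_nz assms)
  then show "\<exists>a. (a \<longlongrightarrow> v) (at p within ball 0 1) \<and> (\<forall>z\<in>ball 0 1. a z \<in> ker_eta z)"
    unfolding v
    by (intro exI [of _ "ker_section (dquot p v)"])
       (auto simp: ker_eta_def ker_section_forms ball_nz simp del: mem_ball)
qed


section \<open>The CR distribution\<close>

text \<open>
  The Hermitian pairing, whose real part is the Euclidean inner product, conjugate-linear in
  the base point.
\<close>

definition herm :: "C2 \<Rightarrow> C2 \<Rightarrow> complex" where
  "herm p v = cnj (fst p) * fst v + cnj (snd p) * snd v"

lemma TS3_iff: "v \<in> TS3 p \<longleftrightarrow> Re (herm p v) = 0"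
  by (cases p; cases v) (simp add: TS3_def herm_def inner_complex_def)

lemma CR_iff: "v \<in> CR p \<longleftrightarrow> herm p v = 0"
  by (auto simp: CR_def TS3_iff complex_eq_iff) (simp_all add: herm_def algebra_simps)

lemma bdry_norm:
  assumes "p \<in> bdry"
  shows "cnj (fst p) * fst p + cnj (snd p) * snd p = 1"
proof -
  have "(cmod (fst p))\<^sup>2 + (cmod (snd p))\<^sup>2 = 1"
    using assms by (cases p) (simp add: bdry_def norm_Pair)
  then have "complex_of_real ((cmod (fst p))\<^sup>2 + (cmod (snd p))\<^sup>2) = 1" by simp
  then show ?thesis by (simp only: of_real_add complex_norm_square mult.commute)
qed

text \<open>
  Away from the sphere, \<open>(1 + z\<^sub>1)\<^sup>2 cnj (1 + z\<^sub>1) \<eta>\<close> is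
  \<open>- 2 ((1 + cnj z\<^sub>1 - |z\<^sub>2|\<^sup>2) dz\<^sub>1 + cnj z\<^sub>2 (1 + z\<^sub>1) dz\<^sub>2)\<close>.  Substituting
  \<open>|z\<^sub>2|\<^sup>2 = 1 - |z\<^sub>1|\<^sup>2\<close> makes \<open>1 + z\<^sub>1\<close> a common factor.
\<close>

lemma eta_bdry:
  assumes p: "p \<in> bdry"
  shows "eta p v = complex_of_real (- 2 / (cmod (1 + fst p))\<^sup>2) * herm p v"
proof -
  define D where "D = 1 + fst p"
  have nz: "1 + fst p \<noteq> 0" using bdry_nz [OF p] .
  then have "D \<noteq> 0" by (simp add: D_def)
  then have D: "D \<noteq> 0" "cnj D \<noteq> 0" by simp_all
  have s: "cnj (snd p) * snd p = 1 - cnj (fst p) * fst p"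
    using bdry_norm [OF p] by (simp add: algebra_simps)
  have "D\<^sup>2 * cnj D * eta p v
      = - 2 * (cnj D * fst v + cnj (snd p) * (D * snd v) - cnj (snd p) * snd p * fst v)"
    using D by (simp add: eta_eq dcayley_eq [OF nz] dquot_eq [OF nz] quot_def D_def [symmetric]
        field_simps power2_eq_square)
  also have "\<dots> = - 2 * D * herm p v"
    unfolding s herm_def D_def by (simp add: algebra_simps)
  finally have "D * (D * cnj D * eta p v) = D * (- 2 * herm p v)"
    by (simp add: power2_eq_square mult.assoc mult.left_commute)
  then have "D * cnj D * eta p v = - 2 * herm p v"
    using D(1) mult_left_cancel by blast
  then have "eta p v = - 2 / (D * cnj D) * herm p v"
    using D by (simp add: field_simps)
  also have "D * cnj D = complex_of_real ((cmod D)\<^sup>2)"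
    by (rule complex_norm_square [symmetric])
  finally show ?thesis by (simp add: D_def)
qed

lemma ker_eta_bdry:
  assumes "p \<in> bdry" shows "ker_eta p = CR p"
  using bdry_nz [OF assms] by (auto simp: ker_eta_def CR_iff eta_bdry [OF assms])

lemma dquot_scaled:
  "1 + fst z \<noteq> 0 \<Longrightarrow> (1 + fst z)\<^sup>2 * dquot z v = (1 + fst z) * snd v - snd z * fst v"
  by (simp add: dquot_eq right_diff_distrib power2_eq_square)

text \<open>
  The vectors of the CR distribution are the multiples \<open>s (- cnj p\<^sub>2, cnj p\<^sub>1)\<close> of a unit vector,
  and on such a vector \<open>(1 + p\<^sub>1)\<^sup>2 dw = cnj (1 + p\<^sub>1) s\<close>, so \<open>|dw| = |s| / |1 + p\<^sub>1|\<close>.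
\<close>

lemma CR_inner_eq:
  assumes p: "p \<in> bdry" and v: "v \<in> CR p" and w: "w \<in> CR p"
  shows "v \<bullet> w = (cmod (1 + fst p))\<^sup>2 * abs_sq dquot p v w"
proof -
  \<comment> \<open>The coefficient \<open>s\<close> is the pairing of \<open>v\<close> with the unit vector.\<close>
  have par: "\<exists>s. v = (- cnj (snd p) * s, cnj (fst p) * s)" if "v \<in> CR p" for v
  proof (intro exI)
    have h: "cnj (fst p) * fst v + cnj (snd p) * snd v = 0"
      using that by (simp add: CR_iff herm_def)
    show "v = (- cnj (snd p) * (fst p * snd v - snd p * fst v), cnj (fst p) * (fst p * snd v - snd p * fst v))"
      using h bdry_norm [OF p] by (simp add: prod_eq_iff) (intro conjI; algebra)
  qed
  have dq: "(1 + fst p)\<^sup>2 * dquot p (- cnj (snd p) * s, cnj (fst p) * s) = cnj (1 + fst p) * s" for s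
    unfolding dquot_scaled [OF bdry_nz [OF p]] using bdry_norm [OF p] by simp algebra
  obtain s t where s: "v = (- cnj (snd p) * s, cnj (fst p) * s)"
    and t: "w = (- cnj (snd p) * t, cnj (fst p) * t)"
    using par [OF v] par [OF w] by blast
  define D where "D = 1 + fst p"
  have "D \<noteq> 0" using bdry_nz [OF p] by (simp add: D_def)
  then have D: "D \<noteq> 0" "cnj D \<noteq> 0" by simp_all
  have dv: "D\<^sup>2 * dquot p v = cnj D * s" and dw: "(cnj D)\<^sup>2 * cnj (dquot p w) = D * cnj t"
    using dq [of s] arg_cong [OF dq [of t], of cnj] by (simp_all add: s t D_def)
  have "(D * cnj D) * ((D * cnj D) * (dquot p v * cnj (dquot p w)))
      = (D\<^sup>2 * dquot p v) * ((cnj D)\<^sup>2 * cnj (dquot p w))"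
    by (simp add: power2_eq_square algebra_simps)
  also have "\<dots> = (D * cnj D) * (s * cnj t)" unfolding dv dw by simp
  finally have "(D * cnj D) * (dquot p v * cnj (dquot p w)) = s * cnj t"
    using D by simp
  then have "Re (complex_of_real ((cmod D)\<^sup>2) * (dquot p v * cnj (dquot p w))) = Re (s * cnj t)"
    by (simp only: complex_norm_square)
  then have "(cmod D)\<^sup>2 * abs_sq dquot p v w = Re (s * cnj t)"
    by (simp add: abs_sq_def)
  also have "\<dots> = Re ((cnj (fst p) * fst p + cnj (snd p) * snd p) * (s * cnj t))"
    by (simp only: bdry_norm [OF p] mult_1_left)
  also have "\<dots> = v \<bullet> w"
    by (simp add: s t inner_complex_def algebra_simps)
  finally show ?thesis by (simp add: D_def)
qed


section \<open>The conformal classes\<close>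

lemma conf_class_cong:
  assumes "\<And>p v w. p \<in> S \<Longrightarrow> v \<in> E p \<Longrightarrow> w \<in> E p \<Longrightarrow> h p v w = h' p v w"
  shows "conf_class S E h = conf_class S E h'"
  unfolding conf_class_def using assms by (simp cong: conj_cong ball_cong)

lemma conf_class_nondegenerate:
  assumes "k \<in> conf_class S E h" "p \<in> S" "nondegenerate (E p) (h p)"
  shows "nondegenerate (E p) (k p)"
proof -
  obtain \<mu> where "\<mu> p > 0" "\<forall>v\<in>E p. \<forall>w\<in>E p. k p v w = \<mu> p * h p v w"
    using assms(1,2) unfolding conf_class_def by blast
  with assms(3) show ?thesis by (auto simp: nondegenerate_def)
qed

lemma nondegenerateI_definite:
  assumes "\<And>v. v \<in> V \<Longrightarrow> b v v = 0 \<Longrightarrow> v = 0"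
  shows "nondegenerate V b"
  using assms unfolding nondegenerate_def by blast

lemma abs_sq_eq_0_iff: "abs_sq \<alpha> z v v = 0 \<longleftrightarrow> \<alpha> z v = 0"
  by (simp add: abs_sq_def complex_eq_iff add_nonneg_eq_0_iff)

lemma nondegenerate_h_pos:
  assumes "c > 0" "p \<in> bdry"
  shows "nondegenerate V (h_pos c p)"
proof (rule nondegenerateI_definite)
  fix v assume "h_pos c p v v = 0"
  then have "2 * (Re (eta p v) * Re (eta p v)) + 1 / 2 * (Im (eta p v) * Im (eta p v))
      + 8 * (c * abs_sq dquot p v v) = 0"
    by (simp add: h_pos_def)
  moreover have "c * abs_sq dquot p v v \<ge> 0" using assms(1) by (simp add: abs_sq_def)
  ultimately have "Re (eta p v) * Re (eta p v) = 0" "Im (eta p v) * Im (eta p v) = 0"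
      "c * abs_sq dquot p v v = 0"
    using zero_le_square [of "Re (eta p v)"] zero_le_square [of "Im (eta p v)"] by linarith+
  then have "eta p v = 0" "dquot p v = 0"
    using assms(1) by (simp_all add: abs_sq_eq_0_iff complex_eq_iff)
  then show "v = 0" by (rule coordinate_forms_injective [OF bdry_nz [OF assms(2)]])
qed

lemma nondegenerate_abs_sq_dquot:
  assumes "p \<in> bdry"
  shows "nondegenerate (CR p) (abs_sq dquot p)"
proof (rule nondegenerateI_definite)
  fix v assume "v \<in> CR p" "abs_sq dquot p v v = 0"
  then have "eta p v = 0" "dquot p v = 0"
    using ker_eta_bdry [OF assms] by (auto simp: abs_sq_eq_0_iff ker_eta_def)
  then show "v = 0" by (rule coordinate_forms_injective [OF bdry_nz [OF assms]])
qed


section \<open>The point at infinity\<close>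

text \<open>
  The leading coefficient of the pole of \<open>h_pos c\<close> at \<open>p_inf\<close>.  It comes from \<open>(Im \<eta>)\<^sup>2\<close> alone,
  since the pole of \<open>|dw|\<^sup>2\<close> is of lower order, and \<open>\<eta>\<close> is there proportional to
  \<open>herm p_inf v = - v\<^sub>1\<close>.
\<close>

definition residue_form :: "C2 \<Rightarrow> C2 \<Rightarrow> real" where
  "residue_form v w = 2 * (Im (fst v) * Im (fst w))"

text \<open>
  On the sphere, \<open>\<eta>\<close> and \<open>dw\<close> become polynomial after multiplication by \<open>|1 + p\<^sub>1|\<^sup>2\<close> and
  \<open>(1 + p\<^sub>1)\<^sup>2\<close> respectively, so the right-hand side has an evident limit at \<open>p_inf\<close>.
\<close>

lemma h_pos_times_pole:
  assumes p: "p \<in> bdry" and v: "v \<in> TS3 p" and w: "w \<in> TS3 p"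
  shows "(cmod ((1 + fst p)\<^sup>2))\<^sup>2 * h_pos c p v w = 2 * (Im (herm p v) * Im (herm p w))
     + 8 * c * Re (((1 + fst p) * snd v - snd p * fst v) * cnj ((1 + fst p) * snd w - snd p * fst w))"
proof -
  define r where "r = (cmod (1 + fst p))\<^sup>2"
  have r: "r \<noteq> 0" using bdry_nz [OF p] by (simp add: r_def)
  have e: "eta p v = complex_of_real (- 2 / r) * herm p v" for v
    unfolding r_def by (rule eta_bdry [OF p])
  have rr: "(cmod ((1 + fst p)\<^sup>2))\<^sup>2 = r\<^sup>2" by (simp add: r_def norm_power)
  have "r\<^sup>2 * (2 * (Re (eta p v) * Re (eta p w)) + 1 / 2 * (Im (eta p v) * Im (eta p w)))
      = 2 * (Im (herm p v) * Im (herm p w))"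
    using r v w by (simp add: e TS3_iff field_simps power2_eq_square)
  moreover have "r\<^sup>2 * abs_sq dquot p v w
      = Re (((1 + fst p)\<^sup>2 * dquot p v) * cnj ((1 + fst p)\<^sup>2 * dquot p w))"
  proof -
    have "((1 + fst p)\<^sup>2 * dquot p v) * cnj ((1 + fst p)\<^sup>2 * dquot p w)
        = ((1 + fst p)\<^sup>2 * cnj ((1 + fst p)\<^sup>2)) * (dquot p v * cnj (dquot p w))"
      by (simp only: complex_cnj_mult mult_ac)
    also have "\<dots> = complex_of_real (r\<^sup>2) * (dquot p v * cnj (dquot p w))"
      by (simp only: rr flip: complex_norm_square)
    finally have "Re (((1 + fst p)\<^sup>2 * dquot p v) * cnj ((1 + fst p)\<^sup>2 * dquot p w))
        = Re (complex_of_real (r\<^sup>2) * (dquot p v * cnj (dquot p w)))"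
      by (rule arg_cong)
    also have "\<dots> = r\<^sup>2 * abs_sq dquot p v w"
      by (simp add: abs_sq_def del: of_real_power)
    finally show ?thesis by (rule sym)
  qed
  ultimately show ?thesis
    unfolding h_pos_def rr dquot_scaled [OF bdry_nz [OF p]]
    by (simp only: distrib_left mult.left_commute [of "r\<^sup>2" "8 * c"])
qed

lemma form_tendsto_pole:
  "form_tendsto bdry TS3 (\<lambda>z v w. (cmod ((1 + fst z)\<^sup>2))\<^sup>2 * h_pos c z v w) p_inf residue_form"
proof (rule form_tendstoI)
  fix v w
  let ?F = "at (p_inf, v, w) within total_space bdry TS3"
  note t = tendsto_at_triple [where T = "total_space bdry TS3"]
  have "((\<lambda>t. 2 * (Im (herm (fst t) (fst (snd t))) * Im (herm (fst t) (snd (snd t))))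
     + 8 * c * Re (((1 + fst (fst t)) * snd (fst (snd t)) - snd (fst t) * fst (fst (snd t)))
         * cnj ((1 + fst (fst t)) * snd (snd (snd t)) - snd (fst t) * fst (snd (snd t)))))
    \<longlongrightarrow> 2 * (Im (herm p_inf v) * Im (herm p_inf w))
     + 8 * c * Re (((1 + fst p_inf) * snd v - snd p_inf * fst v)
         * cnj ((1 + fst p_inf) * snd w - snd p_inf * fst w))) ?F"
    unfolding herm_def by (intro tendsto_intros tendsto_cnj t)
  then show "((\<lambda>t. 2 * (Im (herm (fst t) (fst (snd t))) * Im (herm (fst t) (snd (snd t))))
     + 8 * c * Re (((1 + fst (fst t)) * snd (fst (snd t)) - snd (fst t) * fst (fst (snd t)))
         * cnj ((1 + fst (fst t)) * snd (snd (snd t)) - snd (fst t) * fst (snd (snd t)))))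
    \<longlongrightarrow> residue_form v w) ?F"
    by (simp add: residue_form_def herm_def p_inf_def)
next
  fix z x y assume "z \<in> bdry" "x \<in> TS3 z" "y \<in> TS3 z"
  then show "2 * (Im (herm z x) * Im (herm z y))
     + 8 * c * Re (((1 + fst z) * snd x - snd z * fst x) * cnj ((1 + fst z) * snd y - snd z * fst y))
     = (cmod ((1 + fst z)\<^sup>2))\<^sup>2 * h_pos c z x y"
    using h_pos_times_pole by simp
qed

lemma TS3_p_inf_iff: "v \<in> TS3 p_inf \<longleftrightarrow> Re (fst v) = 0"
  by (simp add: TS3_iff herm_def p_inf_def)

lemma double_pole_bdry_form_pos:
  assumes "c > 0"
  shows "double_pole_at_inf TS3 (bdry_form_pos c)"
proof -
  have "form_tendsto bdry TS3 (\<lambda>z v w. (cmod ((1 + fst z)\<^sup>2))\<^sup>2 * bdry_form_pos c z v w) p_inf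
      residue_form"
  proof (rule form_tendstoI)
    show "((\<lambda>t. (cmod ((1 + fst (fst t))\<^sup>2))\<^sup>2 * h_pos c (fst t) (fst (snd t)) (snd (snd t)))
        \<longlongrightarrow> residue_form v w) (at (p_inf, v, w) within total_space bdry TS3)"
      if "v \<in> TS3 p_inf" "w \<in> TS3 p_inf" for v w
      using form_tendsto_pole [of c] that by (simp add: form_tendsto_def case_prod_unfold)
  qed (simp add: bdry_form_pos_eq assms)
  moreover have "(\<i>, 0) \<in> TS3 p_inf" "residue_form (\<i>, 0) (\<i>, 0) \<noteq> 0"
    by (simp_all add: TS3_p_inf_iff residue_form_def)
  ultimately show ?thesis unfolding double_pole_at_inf_def by blast
qed

lemma at_p_inf_within_bdry: "at p_inf within bdry \<noteq> bot"
proof -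
  have "p_inf islimpt sphere 0 1"
  proof (rule connected_imp_perfect)
    show "connected (sphere (0::C2) 1)" by (rule connected_sphere) simp
    show p: "p_inf \<in> sphere 0 1" by (simp add: p_inf_def norm_Pair)
    show "sphere 0 1 \<noteq> {x}" for x :: C2
    proof
      assume eq: "sphere 0 1 = {x}"
      have "(1, 0) \<in> sphere (0::C2) 1" by (simp add: norm_Pair)
      with p have "p_inf = (1, 0)" unfolding eq by simp
      then show False by (simp add: p_inf_def)
    qed
  qed
  then have "p_inf islimpt bdry"
    unfolding bdry_def islimpt_def by blast
  then show ?thesis by (simp add: trivial_limit_within)
qed

text \<open>
  If \<open>k = \<mu> h\<close> has a limit \<open>b\<close>, then \<open>k = l H\<close>, where \<open>H\<close> is \<open>h\<close> with its pole removed.  On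
  the direction \<open>e = (\<i>, 0)\<close> the form \<open>H\<close> tends to \<open>2\<close>, hence \<open>l\<close> converges.  On
  \<open>f = (0, 1)\<close> the form \<open>H\<close> tends to zero against every tangent vector, hence so does \<open>k\<close>, and
  \<open>f\<close> lies in the radical of \<open>b\<close>.
\<close>

lemma not_extends_across_inf_h_pos: "\<not> extends_across_inf TS3 (conf_class bdry TS3 (h_pos c))"
proof
  assume "extends_across_inf TS3 (conf_class bdry TS3 (h_pos c))"
  then obtain k b \<mu> where b: "form_tendsto bdry TS3 k p_inf b" and nd: "nondegenerate (TS3 p_inf) b"
    and k: "\<And>p v w. p \<in> bdry \<Longrightarrow> v \<in> TS3 p \<Longrightarrow> w \<in> TS3 p \<Longrightarrow> k p v w = \<mu> p * h_pos c p v w"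
    unfolding extends_across_inf_def conf_class_def by blast
  let ?F = "at p_inf within bdry"
  \<comment> \<open>Orthogonal projection onto the tangent space of the sphere extends tangent vectors at
    \<open>p_inf\<close> to nearby points.\<close>
  define P where "P = (\<lambda>v z. v - (z \<bullet> v) *\<^sub>R z :: C2)"
  have P_TS3: "P v z \<in> TS3 z" if "z \<in> bdry" for v z
    using that by (simp add: P_def TS3_def bdry_def inner_diff_right norm_eq_1)
  have P_lim: "(P v \<longlongrightarrow> v) ?F" if "v \<in> TS3 p_inf" for v
  proof -
    have "(P v \<longlongrightarrow> v - (p_inf \<bullet> v) *\<^sub>R p_inf) ?F"
      unfolding P_def by (intro tendsto_intros)
    then show ?thesis using that by (simp add: TS3_def)
  qed
  have sec: "((\<lambda>z. h z (P v z) (P w z)) \<longlongrightarrow> b v w) ?F"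
    if "form_tendsto bdry TS3 h p_inf b" "v \<in> TS3 p_inf" "w \<in> TS3 p_inf" for h b v w
  proof -
    have lim: "filterlim (\<lambda>z. (z, P v z, P w z)) (at (p_inf, v, w) within total_space bdry TS3) ?F"
      by (rule filterlim_section) (auto simp: bdry_def [THEN eqset_imp_iff] P_TS3 P_lim that(2,3))
    have "((\<lambda>(z, x, y). h z x y) \<longlongrightarrow> b v w) (at (p_inf, v, w) within total_space bdry TS3)"
      using that by (simp add: form_tendsto_def)
    from filterlim_compose [OF this lim] show ?thesis by simp
  qed
  define H where "H = (\<lambda>z v w. (cmod ((1 + fst z)\<^sup>2))\<^sup>2 * h_pos c z v w)"
  define l where "l = (\<lambda>z. \<mu> z / (cmod ((1 + fst z)\<^sup>2))\<^sup>2)"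
  have bd: "\<forall>\<^sub>F z in ?F. z \<in> bdry"
    unfolding eventually_at_filter by (rule always_eventually) simp
  have kH: "k z (P v z) (P w z) = l z * H z (P v z) (P w z)" if "z \<in> bdry" for v w z
    using bdry_nz [OF that] k [OF that P_TS3 [OF that] P_TS3 [OF that]] by (simp add: H_def l_def)
  have H: "form_tendsto bdry TS3 H p_inf residue_form"
    unfolding H_def by (rule form_tendsto_pole)
  \<comment> \<open>A direction in which the residue does not vanish, and one in its radical.\<close>
  let ?e = "(\<i>, 0) :: C2" and ?f = "(0, 1) :: C2"
  have e: "?e \<in> TS3 p_inf" and f: "?f \<in> TS3 p_inf" by (simp_all add: TS3_p_inf_iff)
  have He: "((\<lambda>z. H z (P ?e z) (P ?e z)) \<longlongrightarrow> 2) ?F"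
    using sec [OF H e e] by (simp add: residue_form_def)
  have l: "(l \<longlongrightarrow> b ?e ?e / 2) ?F"
  proof (rule Lim_transform_eventually)
    show "((\<lambda>z. k z (P ?e z) (P ?e z) / H z (P ?e z) (P ?e z)) \<longlongrightarrow> b ?e ?e / 2) ?F"
      by (intro tendsto_divide sec [OF b e e] He) simp
    have "\<forall>\<^sub>F z in ?F. H z (P ?e z) (P ?e z) \<noteq> 0"
      using He by (rule tendsto_imp_eventually_ne) simp
    with bd show "\<forall>\<^sub>F z in ?F. k z (P ?e z) (P ?e z) / H z (P ?e z) (P ?e z) = l z"
      by eventually_elim (simp add: kH)
  qed
  have "b ?f w = 0" if w: "w \<in> TS3 p_inf" for w
  proof -
    have "((\<lambda>z. l z * H z (P ?f z) (P w z)) \<longlongrightarrow> b ?e ?e / 2 * residue_form ?f w) ?F"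
      by (intro tendsto_mult l sec [OF H f w])
    moreover have "((\<lambda>z. l z * H z (P ?f z) (P w z)) \<longlongrightarrow> b ?f w) ?F"
    proof (rule Lim_transform_eventually [OF sec [OF b f w]])
      show "\<forall>\<^sub>F z in ?F. k z (P ?f z) (P w z) = l z * H z (P ?f z) (P w z)"
        using bd by eventually_elim (rule kH)
    qed
    ultimately have "b ?f w = b ?e ?e / 2 * residue_form ?f w"
      using tendsto_unique at_p_inf_within_bdry by blast
    then show ?thesis by (simp add: residue_form_def)
  qed
  then have "?f = 0" using nd f unfolding nondegenerate_def by blast
  then show False by (simp add: zero_prod_def)
qed

lemma Ck_on_const: "Ck_on k U (\<lambda>_. c)"
  by (induction k arbitrary: c) simp_all

lemma Ck_on_affine:
  assumes "bounded_linear f"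
  shows "Ck_on k U (\<lambda>x. f x + c)"
proof -
  have d: "((\<lambda>x. f x + c) has_derivative f) (at x)" for x
    using has_derivative_add [OF bounded_linear_imp_has_derivative [OF assms] has_derivative_const]
    by simp
  show ?thesis
  proof (cases k)
    case 0
    then show ?thesis
      using continuous_on_add [OF linear_continuous_on [OF assms] continuous_on_const] by simp
  next
    case (Suc j)
    have "frechet_derivative (\<lambda>x. f x + c) (at x) v = f v" for x v
      using frechet_derivative_at [OF d] by metis
    then show ?thesis using d by (auto simp: Suc Ck_on_const differentiable_def)
  qed
qed

text \<open>
  A quadratic polynomial: its directional derivatives are affine, so \<open>Ck_on_affine\<close> supplies
  all higher orders.
\<close>

lemma smooth_pole_factor: "smooth_on S (\<lambda>z::C2. (cmod (1 + fst z))\<^sup>2)"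
proof -
  let ?F = "\<lambda>z::C2. (cmod (1 + fst z))\<^sup>2"
  have F: "?F = (\<lambda>z. (1 + Re (fst z))\<^sup>2 + (Im (fst z))\<^sup>2)" by (simp add: cmod_power2)
  define F' where "F' = (\<lambda>(z :: C2) (v :: C2). 2 * Re (fst v) * Re (fst z) + 2 * Im (fst v) * Im (fst z)
      + 2 * Re (fst v))"
  have d: "(?F has_derivative F' z) (at z)" for z :: C2
    unfolding F F'_def
    by (auto intro!: derivative_eq_intros simp: algebra_simps)
  have "frechet_derivative ?F (at z) v = F' z v" for z v :: C2
    using frechet_derivative_at [OF d] by metis
  moreover have "Ck_on k UNIV (\<lambda>z. F' z v)" for k v
    unfolding F'_def
    by (intro Ck_on_affine bounded_linear_add bounded_linear_const_mult
        bounded_linear_compose [OF bounded_linear_Re] bounded_linear_compose [OF bounded_linear_Im]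
        bounded_linear_fst)
  moreover have "?F differentiable (at z)" for z
    using d by (rule differentiableI)
  moreover have "continuous_on UNIV ?F" by (intro continuous_intros)
  ultimately have "Ck_on k UNIV ?F" for k by (cases k) simp_all
  then show ?thesis
    unfolding smooth_on_def by (intro exI [of _ UNIV] exI [of _ ?F]) auto
qed

text \<open>
  The Euclidean inner product itself is a representative of the class, with conformal factor
  \<open>|1 + z\<^sub>1|\<^sup>2\<close>; this factor vanishes at \<open>p_inf\<close>, which the punctured sphere excludes.
\<close>

lemma extends_across_inf_abs_sq_dquot:
  "extends_across_inf CR (conf_class bdry CR (abs_sq dquot))"
  unfolding extends_across_inf_def
proof (intro bexI exI conjI)
  show "form_tendsto bdry CR (\<lambda>_. (\<bullet>)) p_inf (\<bullet>)"
    by (rule form_tendstoI [of _ _ "\<lambda>_. (\<bullet>)"]) (intro tendsto_inner tendsto_at_triple, simp)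
  show "nondegenerate (CR p_inf) (\<bullet>)"
    by (rule nondegenerateI_definite) simp
  show "(\<lambda>_. (\<bullet>)) \<in> conf_class bdry CR (abs_sq dquot)"
    unfolding conf_class_def
    by (intro CollectI exI [of _ "\<lambda>z. (cmod (1 + fst z))\<^sup>2"] conjI smooth_pole_factor)
       (auto simp: bdry_nz CR_inner_eq)
qed


section \<open>The boundary conformal structures\<close>

theorem proposition1:
  shows
    "(\<forall>c::real. c > 0 \<longrightarrow>
        (\<forall>p\<in>bdry. extends_to_bdry (\<lambda>_. UNIV) (scaled_pos c) p)
      \<and> double_pole_at_inf TS3 (bdry_form_pos c)
      \<and> \<not> extends_across_inf TS3 (conf_inf_pos c)
      \<and> conf_inf_pos c = conf_class bdry TS3 (h_pos c)
      \<and> (\<forall>k\<in>conf_inf_pos c. \<forall>p\<in>bdry. nondegenerate (TS3 p) (k p)))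
   \<and> (\<forall>p\<in>bdry. ker_eta p = CR p)
   \<and> (\<forall>p\<in>bdry. \<forall>v. v \<notin> CR p \<longrightarrow>
        filterlim (\<lambda>(z, x). scaled_zero z x x) at_top (at (p, v) within ball 0 1 \<times> UNIV))
   \<and> (\<forall>p\<in>bdry. extends_to_bdry ker_eta scaled_zero p)
   \<and> conf_inf_zero = conf_class bdry CR (abs_sq dquot)
   \<and> (\<forall>k\<in>conf_inf_zero. \<forall>p\<in>bdry. nondegenerate (CR p) (k p))
   \<and> extends_across_inf CR conf_inf_zero"
proof -
  have pos: "conf_inf_pos c = conf_class bdry TS3 (h_pos c)" if "c > 0" for c
    unfolding conf_inf_pos_def by (rule conf_class_cong) (simp add: bdry_form_pos_eq that)
  have zero: "conf_inf_zero = conf_class bdry CR (abs_sq dquot)"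
    unfolding conf_inf_zero_def
    by (rule conf_class_cong) (simp add: bdry_form_zero_eq ker_eta_bdry)
  have blow_up: "filterlim (\<lambda>(z, x). scaled_zero z x x) at_top (at (p, v) within ball 0 1 \<times> UNIV)"
    if "p \<in> bdry" "v \<notin> CR p" for p v
    using that ker_eta_bdry [OF that(1)] by (intro scaled_zero_at_top) (auto simp: ker_eta_def)
  show ?thesis
  proof (intro conjI allI impI ballI)
    show "extends_to_bdry (\<lambda>_. UNIV) (scaled_pos c) p" if "c > 0" "p \<in> bdry" for c p
      using form_tendsto_scaled_pos [OF that] by (auto simp: extends_to_bdry_def)
    show "extends_to_bdry ker_eta scaled_zero p" if "p \<in> bdry" for p
      using form_tendsto_scaled_zero [OF that] by (auto simp: extends_to_bdry_def)
    show "nondegenerate (TS3 p) (k p)" if "c > 0" "k \<in> conf_inf_pos c" "p \<in> bdry" for c k p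
      using that conf_class_nondegenerate nondegenerate_h_pos by (metis pos)
    show "nondegenerate (CR p) (k p)" if "k \<in> conf_inf_zero" "p \<in> bdry" for k p
      using that conf_class_nondegenerate nondegenerate_abs_sq_dquot by (metis zero)
  qed (simp_all add: double_pole_bdry_form_pos pos not_extends_across_inf_h_pos ker_eta_bdry blow_up zero
      extends_across_inf_abs_sq_dquot)
qed

end
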